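(* Let $\mathbf{g}(t): \mathbb{R} \to \mathbb{R}^n$ be a smooth function such that the constants $$M_j := \max_{t \in [0,\Delta T]} \| \mathbf{g}^{(j)}(t) \|, \qquad j = 0, \dots, n,$$ are bounded. Furthermore, let the subinterval length $\Delta T$ be small in the sense that $(\Delta T)^2 \ll \Delta T$. Then for the singular values $\sigma_j$, $j = 1, \dots, s$, of the sample matrix $$G = \begin{bmatrix} \mathbf{g}(t_1) & \mathbf{g}(t_2) & \dots & \mathbf{g}(t_s) \end{bmatrix} \in \mathbb{R}^{n \times s}$$ it holds that $$\sigma_{j+1} = \sqrt{s-j}\; O(\Delta T)^j, \qquad j = 1, \dots, s-1.$$
   Context: The function $\mathbf{g}$ is a time-dependent source term, sampled at $s$ points in time $0 = t_1 < t_2 < \dots < t_{s-1} < t_s = \Delta T$ of the time interval $[0,\Delta T]$, where the number of samples satisfies $s \ll n$. The columns of $G$ are the sample vectors $\mathbf{g}(t_i)$. Here $\mathbf{g}^{(j)}$ denotes the $j$th derivative of $\mathbf{g}$ (with $\mathbf{g}^{(0)} = \mathbf{g}$), $\|\cdot\|$ is a norm on $\mathbb{R}^n$, and the singular values are ordered as $\sigma_1 \ge \sigma_2 \ge \dots \ge \sigma_s$. Time is measured in dimensionless units, and $O(\Delta T)^j$ denotes a quantity of order $(\Delta T)^j$. *)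

theory Defs
  imports
    "HOL-Analysis.Derivative"
    "Jordan_Normal_Form.Char_Poly"
begin

(* Column vectors and matrices are those of Jordan_Normal_Form, with explicit dimensions, so that
   both n and the number of samples s can be quantified over; "$" is vector indexing there. *)
unbundle no vec_syntax

definition norm_on_carrier_vec :: "nat \<Rightarrow> (real vec \<Rightarrow> real) \<Rightarrow> bool" where
  "norm_on_carrier_vec n N \<longleftrightarrow>
     (\<forall>x \<in> carrier_vec n. 0 \<le> N x \<and> (N x = 0 \<longleftrightarrow> x = 0\<^sub>v n)) \<and>
     (\<forall>x \<in> carrier_vec n. \<forall>c. N (c \<cdot>\<^sub>v x) = \<bar>c\<bar> * N x) \<and>
     (\<forall>x \<in> carrier_vec n. \<forall>y \<in> carrier_vec n. N (x + y) \<le> N x + N y)"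

definition smooth_curve :: "nat \<Rightarrow> (real \<Rightarrow> real vec) \<Rightarrow> bool" where
  "smooth_curve n g \<longleftrightarrow>
     (\<forall>t. g t \<in> carrier_vec n) \<and>
     (\<forall>i<n. \<forall>j t. ((deriv ^^ j) (\<lambda>u. g u $ i)) differentiable (at t))"

definition curve_deriv :: "nat \<Rightarrow> nat \<Rightarrow> (real \<Rightarrow> real vec) \<Rightarrow> real \<Rightarrow> real vec" where
  "curve_deriv n j g t = vec n (\<lambda>i. (deriv ^^ j) (\<lambda>u. g u $ i) t)"

(* For a smooth curve the supremum is attained, so this is the maximum M_j over [0,T]. *)
definition max_deriv :: "nat \<Rightarrow> (real vec \<Rightarrow> real) \<Rightarrow> (real \<Rightarrow> real vec) \<Rightarrow> nat \<Rightarrow> real \<Rightarrow> real" where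
  "max_deriv n N g j T = (SUP t \<in> {0..T}. N (curve_deriv n j g t))"

(* Sample points and singular values are indexed from 1. *)
definition sample_points :: "nat \<Rightarrow> real \<Rightarrow> (nat \<Rightarrow> real) \<Rightarrow> bool" where
  "sample_points s T t \<longleftrightarrow> 2 \<le> s \<and> t 1 = 0 \<and> t s = T \<and> strict_mono_on {1..s} t"

definition sample_matrix :: "nat \<Rightarrow> nat \<Rightarrow> (real \<Rightarrow> real vec) \<Rightarrow> (nat \<Rightarrow> real) \<Rightarrow> real mat" where
  "sample_matrix n s g t = mat_of_cols n (map (\<lambda>k. g (t k)) [1..<s + 1])"

(* Square roots of the eigenvalues of A^T A, with multiplicity, in descending order.  A^T A is
   positive semidefinite, so its characteristic polynomial has exactly dim_col A real roots, all
   nonnegative, and the list has length dim_col A. *)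
definition singular_values :: "real mat \<Rightarrow> real list" where
  "singular_values A =
     rev (sorted_list_of_multiset (image_mset sqrt (proots (char_poly (transpose_mat A * A)))))"

definition singular_value :: "real mat \<Rightarrow> nat \<Rightarrow> real" where
  "singular_value A k = singular_values A ! (k - 1)"

end

theory Submission
  imports Defs "Jordan_Normal_Form.Schur_Decomposition"
begin

text \<open>
  Each coordinate of \<open>g\<close> agrees on \<open>[0,T]\<close> with its Taylor polynomial of degree less than \<open>j\<close> at \<open>0\<close>,
  up to an error of order \<open>T ^ j\<close>. Hence the sample matrix \<open>G\<close> is a matrix of rank at most \<open>j\<close>, namely
  the Taylor coefficients times the Vandermonde rows \<open>(t\<^sub>1 ^ m, \<dots>, t\<^sub>s ^ m)\<close> with \<open>m < j\<close>, plus a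
  remainder whose entries are \<open>O(T ^ j)\<close>. A perturbation of a matrix of rank at most \<open>j\<close> has
  \<open>\<sigma>\<^sub>j\<^sub>+\<^sub>1\<close> at most the operator norm of the perturbation, and here that norm is at most
  \<open>sqrt (n * s)\<close> times the largest entry. As \<open>s < n\<close> and \<open>sqrt (s - j) \<ge> 1\<close>, all remaining factors go into
  the constant.

  Singular values are here the square roots of the roots of the characteristic polynomial of
  \<open>G\<^sup>T G\<close>, so the perturbation bound rests on the spectral theorem for real symmetric matrices:
  the characteristic polynomial splits over the reals (\<open>char_poly_symmetric_splits\<close>), and for its roots in
  any prescribed order there is an orthonormal eigenbasis (\<open>symmetric_orthogonal_diagonalization\<close>).
  With the roots in descending order, the span of the first \<open>j + 1\<close> eigenvectors contains a nonzero
  \<open>x\<close> killed by the \<open>j\<close> Vandermonde rows (\<open>symmetric_rayleigh_lower_bound\<close>), and comparing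
  \<open>\<sigma>\<^sub>j\<^sub>+\<^sub>1\<^sup>2 \<bar>x\<bar>\<^sup>2 \<le> \<bar>G x\<bar>\<^sup>2\<close> with the size of the remainder gives
  \<open>singular_value_le_of_low_rank_approx\<close>.

  The derivative bounds are given in an arbitrary norm, whereas Taylor's theorem is applied to
  coordinates; \<open>coordinate_le_norm\<close>, the equivalence of norms in finite dimension, connects the two.
\<close>

(* Here the symbol \<bullet> stands for the scalar product of carrier-based vectors only. *)
unbundle no inner_syntax

section \<open>Real symmetric matrices\<close>

lemma scalar_prod_self_eq_sum:
  fixes v :: "real vec"
  assumes "v \<in> carrier_vec n"
  shows "v \<bullet> v = (\<Sum>i<n. (v $ i)\<^sup>2)"
  using assms by (simp add: scalar_prod_def power2_eq_square atLeast0LessThan carrier_vecD)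

lemma scalar_prod_self_pos:
  fixes v :: "real vec"
  assumes "v \<in> carrier_vec n" "v \<noteq> 0\<^sub>v n"
  shows "0 < v \<bullet> v"
proof -
  obtain i where i: "i < n" "v $ i \<noteq> 0"
    using assms by (metis carrier_vecD eq_vecI index_zero_vec)
  then have "0 < (v $ i)\<^sup>2" by simp
  also have "\<dots> \<le> v \<bullet> v"
    unfolding scalar_prod_self_eq_sum[OF assms(1)] using i by (intro member_le_sum) auto
  finally show ?thesis .
qed

text \<open>
  For an eigenvector \<open>v\<close> of \<open>a\<close>, the number \<open>v\<^sup>* A v = a \<bar>v\<bar>\<^sup>2\<close> equals its own conjugate by symmetry.
\<close>

lemma real_symmetric_eigenvalues_real:
  fixes A :: "real mat"
  assumes A: "A \<in> carrier_mat n n" and sym: "transpose_mat A = A"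
    and root: "poly (char_poly (map_mat complex_of_real A)) a = 0"
  shows "Im a = 0"
proof -
  let ?A = "map_mat complex_of_real A"
  have cA: "?A \<in> carrier_mat n n" using A by simp
  have "eigenvalue ?A a"
    using root eigenvalue_root_char_poly[OF cA] by simp
  then obtain v where v: "v \<in> carrier_vec n" "v \<noteq> 0\<^sub>v n" "?A *\<^sub>v v = a \<cdot>\<^sub>v v"
    unfolding eigenvalue_def eigenvector_def using cA by auto
  have entry: "A $$ (i,k) = A $$ (k,i)" if "i < n" "k < n" for i k
    using arg_cong[OF sym, of "\<lambda>M. M $$ (i,k)"] that A by simp
  have row: "(\<Sum>k<n. of_real (A $$ (i,k)) * v $ k) = a * v $ i" if "i < n" for i
    using arg_cong[OF v(3), of "\<lambda>w. w $ i"] that A v(1)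
    by (simp add: scalar_prod_def atLeast0LessThan)
  define q where "q = (\<Sum>i<n. \<Sum>k<n. cnj (v $ i) * (of_real (A $$ (i,k)) * v $ k))"
  define d where "d = (\<Sum>i<n. (cmod (v $ i))\<^sup>2)"
  have "q = (\<Sum>i<n. cnj (v $ i) * (a * v $ i))"
    unfolding q_def by (intro sum.cong refl) (simp add: sum_distrib_left[symmetric] row)
  also have "\<dots> = a * of_real d"
    unfolding d_def of_real_sum sum_distrib_left
    by (intro sum.cong refl) (simp only: complex_norm_square mult_ac)
  finally have q: "q = a * of_real d" .
  have "cnj q = (\<Sum>i<n. \<Sum>k<n. cnj (v $ k) * (of_real (A $$ (k,i)) * v $ i))"
    unfolding q_def by (auto simp: entry intro!: sum.cong)
  also have "\<dots> = q"
    unfolding q_def by (rule sum.swap)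
  finally have "cnj a * of_real d = a * of_real d" by (simp add: q)
  moreover have "d \<noteq> 0"
  proof
    assume "d = 0"
    then have "\<forall>i<n. v $ i = 0"
      unfolding d_def by (subst (asm) sum_nonneg_eq_0_iff) auto
    then have "v = 0\<^sub>v n" using v(1) by (intro eq_vecI) auto
    with v(2) show False by simp
  qed
  ultimately have "cnj a = a" by simp
  then show ?thesis by (simp add: complex_eq_iff)
qed

text \<open>
  The complex factorization has only real roots, and so it descends to the reals.
\<close>

lemma char_poly_symmetric_splits:
  fixes A :: "real mat"
  assumes A: "A \<in> carrier_mat n n" and sym: "transpose_mat A = A"
  obtains es where "char_poly A = (\<Prod>e\<leftarrow>es. [:- e, 1:])"
proof -
  let ?A = "map_mat complex_of_real A"
  have cA: "?A \<in> carrier_mat n n" using A by simp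
  obtain as where as: "char_poly ?A = (\<Prod>a\<leftarrow>as. [:- a, 1:])"
    using char_poly_factorized[OF cA] by blast
  have "a = of_real (Re a)" if "a \<in> set as" for a
  proof -
    have "poly (char_poly ?A) a = 0"
      using that by (auto simp: as poly_prod_list prod_list_zero_iff)
    from real_symmetric_eigenvalues_real[OF A sym this] show ?thesis
      by (simp add: complex_eq_iff)
  qed
  then have map_as: "map (\<lambda>a. complex_of_real (Re a)) as = as"
    by (intro map_idI) simp
  interpret h: map_poly_inj_idom_hom complex_of_real ..
  have "map_poly complex_of_real (\<Prod>a\<leftarrow>as. [:- Re a, 1:]) = (\<Prod>a\<leftarrow>as. [:- complex_of_real (Re a), 1:])"
    by (simp add: h.hom_prod_list o_def)
  also have "\<dots> = (\<Prod>a\<leftarrow>map (\<lambda>a. complex_of_real (Re a)) as. [:- a, 1:])"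
    by (simp add: o_def)
  also have "\<dots> = map_poly complex_of_real (char_poly A)"
    unfolding map_as as[symmetric] by (rule of_real_hom.char_poly_hom[OF A])
  finally have "char_poly A = (\<Prod>e\<leftarrow>map Re as. [:- e, 1:])"
    by (simp add: o_def)
  then show ?thesis by (rule that)
qed

text \<open>
  This is Gram--Schmidt applied to a basis that starts with \<open>v\<close>, followed by normalization of the
  columns. Unlike mere orthogonality of the columns, the normalization makes \<open>W\<^sup>T\<close> the inverse of \<open>W\<close>,
  so that conjugation by \<open>W\<close> keeps a matrix symmetric.
\<close>

lemma orthogonal_mat_with_first_col:
  fixes v :: "real vec"
  assumes v: "v \<in> carrier_vec n" "v \<noteq> 0\<^sub>v n"
  obtains W c where "W \<in> carrier_mat n n" "transpose_mat W * W = 1\<^sub>m n" "col W 0 = c \<cdot>\<^sub>v v"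
proof -
  interpret cof_vec_space n "TYPE(real)" .
  define b where "b = basis_completion v"
  define ws where "ws = gram_schmidt n b"
  define l where "l = (\<lambda>k. sqrt (ws ! k \<bullet> ws ! k))"
  define W where "W = mat n n (\<lambda>(i,k). ws ! k $ i / l k)"
  from basis_completion[OF v, folded b_def]
  have b: "set b \<subseteq> carrier_vec n" "distinct b" "\<not> lin_dep (set b)" "hd b = v" "length b = n"
    by auto
  have n: "n \<noteq> 0" using v by (auto intro!: eq_vecI)
  from b n obtain vs where bv: "b = v # vs" by (cases b) auto
  from gram_schmidt_result[OF b(1-3) refl, folded ws_def] b
  have ws: "set ws \<subseteq> carrier_vec n" "corthogonal ws" "length ws = n" by auto
  have ws0: "ws ! 0 = v"
    using gram_schmidt_hd[OF v(1), of vs, folded bv ws_def] ws(3) n hd_conv_nth[of ws] by fastforce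
  have wsc: "ws ! k \<in> carrier_vec n" if "k < n" for k using ws that by auto
  have orth: "ws ! i \<bullet> ws ! k = 0 \<longleftrightarrow> i \<noteq> k" if "i < n" "k < n" for i k
    using corthogonalD[OF ws(2), of i k] that ws(3) by (simp add: conjugate_vec_def)
  have pos: "l k > 0" if "k < n" for k
  proof -
    have "ws ! k \<bullet> ws ! k \<ge> 0" by (simp add: scalar_prod_def sum_nonneg)
    then show ?thesis using orth[OF that that] by (simp add: l_def)
  qed
  have W: "W \<in> carrier_mat n n" by (simp add: W_def)
  have "transpose_mat W * W = 1\<^sub>m n"
  proof (rule eq_matI; simp add: W)
    fix i k assume ik: "i < n" "k < n"
    have "col W i \<bullet> col W k = ws ! i \<bullet> ws ! k / (l i * l k)"
      using ik wsc[OF ik(1)] wsc[OF ik(2)]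
      by (simp add: W_def scalar_prod_def sum_divide_distrib carrier_vecD)
    then show "(i = k \<longrightarrow> (transpose_mat W * W) $$ (k, k) = 1) \<and>
      (i \<noteq> k \<longrightarrow> (transpose_mat W * W) $$ (i, k) = 0)"
      using ik orth[of i k] pos[of k] W by (auto simp: l_def)
  qed (use W in auto)
  moreover have "col W 0 = (1 / l 0) \<cdot>\<^sub>v v"
    using n v by (intro eq_vecI) (auto simp: W_def ws0)
  ultimately show ?thesis using W that by blast
qed

text \<open>
  The list \<open>es\<close> is an input, so that the eigenvectors can later be demanded in descending order of the
  eigenvalues. The induction splits off the first root: in an orthonormal basis that starts with one of
  its eigenvectors, the first column of the matrix is that of a diagonal matrix, by symmetry so is the
  first row, and the remaining block is symmetric with the remaining roots.
\<close>

lemma symmetric_orthogonal_diagonalization: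
  fixes A :: "real mat"
  assumes "A \<in> carrier_mat n n" "transpose_mat A = A"
    and "char_poly A = (\<Prod>e\<leftarrow>es. [:- e, 1:])"
  shows "\<exists>P\<in>carrier_mat n n. transpose_mat P * P = 1\<^sub>m n \<and>
           transpose_mat P * (A * P) = mat_diag n (\<lambda>i. es ! i)"
  using assms
proof (induction es arbitrary: n A)
  case Nil
  with degree_monic_char_poly[of A n] have "n = 0" by simp
  then show ?case using Nil by (intro bexI[of _ "1\<^sub>m 0"]) (auto intro!: eq_matI simp: mat_diag_def)
next
  case (Cons e es n A)
  note A = \<open>A \<in> carrier_mat n n\<close> and sym = \<open>transpose_mat A = A\<close>
  have "n \<noteq> 0"
  proof
    assume "n = 0"
    with degree_monic_char_poly[OF A] have "degree (char_poly A) = 0" by simp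
    moreover have "char_poly A \<noteq> 0" using degree_monic_char_poly[OF A] by auto
    moreover have "poly (char_poly A) e = 0" using Cons.prems(3) by simp
    ultimately show False by (metis degree_eq_zeroE pCons_0_0 poly_0 poly_pCons mult_zero_right add.right_neutral)
  qed
  then obtain m where n: "n = Suc m" by (cases n) auto
  have "eigenvalue A e"
    using eigenvalue_root_char_poly[OF A] Cons.prems(3) by simp
  then obtain v where v: "v \<in> carrier_vec n" "v \<noteq> 0\<^sub>v n" "A *\<^sub>v v = e \<cdot>\<^sub>v v"
    unfolding eigenvalue_def eigenvector_def using A by auto
  obtain W c where W: "W \<in> carrier_mat n n" and WW: "transpose_mat W * W = 1\<^sub>m n"
    and W0: "col W 0 = c \<cdot>\<^sub>v v"
    using orthogonal_mat_with_first_col[OF v(1,2)] .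
  define Wt where "Wt = transpose_mat W"
  have Wt: "Wt \<in> carrier_mat n n" using W by (simp add: Wt_def)
  have WtW: "Wt * W = 1\<^sub>m n" using WW by (simp add: Wt_def)
  have WWt: "W * Wt = 1\<^sub>m n" using mat_mult_left_right_inverse[OF Wt W WtW] .
  define A' where "A' = Wt * (A * W)"
  have A': "A' \<in> carrier_mat n n" using A W Wt by (simp add: A'_def)
  have "transpose_mat A' = transpose_mat (A * W) * transpose_mat Wt"
    unfolding A'_def using A W Wt by (intro transpose_mult) auto
  also have "transpose_mat (A * W) = Wt * A"
    using transpose_mult[OF A W] sym by (simp add: Wt_def)
  also have "Wt * A * transpose_mat Wt = A'"
    unfolding A'_def using A W Wt by (simp add: Wt_def assoc_mult_mat[of _ n n _ n _ n])
  finally have sym': "transpose_mat A' = A'" .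
  have entry: "A' $$ (i,k) = A' $$ (k,i)" if "i < n" "k < n" for i k
    using arg_cong[OF sym', of "\<lambda>M. M $$ (i,k)"] that A' by simp
  have ev0: "A *\<^sub>v col W 0 = e \<cdot>\<^sub>v col W 0"
    using v A by (simp add: W0 mult_mat_vec[of _ n n] smult_smult_assoc mult.commute)
  have "A' $$ (i,0) = (if i = 0 then e else 0)" if "i < n" for i
  proof -
    have "col (A * W) 0 = e \<cdot>\<^sub>v col W 0" using col_mult2[OF A W, of 0] n ev0 by simp
    then have "A' $$ (i,0) = e * (row Wt i \<bullet> col W 0)"
      unfolding A'_def using that A W Wt n by simp
    also have "row Wt i \<bullet> col W 0 = (Wt * W) $$ (i,0)"
      using that W Wt n by simp
    finally show ?thesis using that n by (simp add: WtW)
  qed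
  note col0 = this
  define A3 where "A3 = mat m m (\<lambda>(i,k). A' $$ (Suc i, Suc k))"
  have A3: "A3 \<in> carrier_mat m m" by (simp add: A3_def)
  let ?E = "mat 1 1 (\<lambda>_. e)"
  have block: "A' = four_block_mat ?E (0\<^sub>m 1 m) (0\<^sub>m m 1) A3"
  proof (rule eq_matI)
    fix i k assume "i < dim_row (four_block_mat ?E (0\<^sub>m 1 m) (0\<^sub>m m 1) A3)"
      "k < dim_col (four_block_mat ?E (0\<^sub>m 1 m) (0\<^sub>m m 1) A3)"
    then have "i < Suc m" "k < Suc m" using A3 by auto
    then show "A' $$ (i,k) = four_block_mat ?E (0\<^sub>m 1 m) (0\<^sub>m m 1) A3 $$ (i,k)"
      using col0[of i] col0[of k] entry[of 0 k] n
      by (cases i; cases k) (auto simp: A3_def)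
  qed (use A' n A3 in auto)
  have sym3: "transpose_mat A3 = A3"
    using entry n by (intro eq_matI) (auto simp: A3_def)
  have "similar_mat A A'"
  proof (rule similar_matI[OF _ WWt WtW])
    have "W * A' * Wt = (W * Wt) * A * (W * Wt)"
      unfolding A'_def using A W Wt by (simp add: assoc_mult_mat[of _ n n _ n _ n])
    then show "A = W * A' * Wt" using A by (simp add: WWt)
  qed (use A A' W Wt in auto)
  then have "char_poly A = char_poly A'" by (rule char_poly_similar)
  also have "\<dots> = char_poly ?E * char_poly A3"
    unfolding block by (rule char_poly_four_block_zeros_col) (use A3 in auto)
  also have "char_poly ?E = [:- e, 1:]"
    by (simp add: char_poly_defs det_def sign_def)
  finally have "[:- e, 1:] * char_poly A3 = [:- e, 1:] * (\<Prod>e\<leftarrow>es. [:- e, 1:])"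
    using Cons.prems(3) by simp
  then have "char_poly A3 = (\<Prod>e\<leftarrow>es. [:- e, 1:])"
    by (metis mult_cancel_left pCons_eq_0_iff zero_neq_one)
  from Cons.IH[OF A3 sym3 this] obtain P3 where P3: "P3 \<in> carrier_mat m m"
    and PP3: "transpose_mat P3 * P3 = 1\<^sub>m m"
    and D3: "transpose_mat P3 * (A3 * P3) = mat_diag m (\<lambda>i. es ! i)" by blast
  define F where "F = four_block_mat (1\<^sub>m 1) (0\<^sub>m 1 m) (0\<^sub>m m 1) P3"
  define Ft where "Ft = transpose_mat F"
  have F: "F \<in> carrier_mat n n"
    using four_block_carrier_mat[of "1\<^sub>m 1" 1 1 P3 m m] P3 n by (simp add: F_def)
  have Ft: "Ft \<in> carrier_mat n n" using F by (simp add: Ft_def)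
  have Ft_eq: "Ft = four_block_mat (1\<^sub>m 1) (0\<^sub>m 1 m) (0\<^sub>m m 1) (transpose_mat P3)"
    unfolding Ft_def F_def using P3
    by (subst transpose_four_block_mat[of _ 1 1 _ m _ m]) auto
  have FtF: "Ft * F = 1\<^sub>m n"
  proof -
    have "Ft * F = four_block_mat (1\<^sub>m 1) (0\<^sub>m 1 m) (0\<^sub>m m 1) (1\<^sub>m m)"
      unfolding Ft_eq F_def using P3 PP3
      by (subst mult_four_block_mat[of _ 1 1 _ m _ m _ _ 1 _ m]) auto
    then show ?thesis using n by (auto intro!: eq_matI)
  qed
  have FtAF: "Ft * (A' * F) = mat_diag n (\<lambda>i. (e # es) ! i)"
  proof -
    have "A' * F = four_block_mat ?E (0\<^sub>m 1 m) (0\<^sub>m m 1) (A3 * P3)"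
      unfolding block F_def using P3 A3
      by (subst mult_four_block_mat[of _ 1 1 _ m _ m _ _ 1 _ m]) auto
    then have "Ft * (A' * F) = four_block_mat ?E (0\<^sub>m 1 m) (0\<^sub>m m 1) (mat_diag m (\<lambda>i. es ! i))"
      unfolding Ft_eq using P3 A3 D3
      by (simp, subst mult_four_block_mat[of _ 1 1 _ m _ m _ _ 1 _ m]) auto
    also have "\<dots> = mat_diag n (\<lambda>i. (e # es) ! i)"
      unfolding mat_diag_def n by (rule eq_matI) (auto simp: nth_Cons')
    finally show ?thesis .
  qed
  have tWF: "transpose_mat (W * F) = Ft * Wt"
    using transpose_mult[OF W F] by (simp add: Ft_def Wt_def)
  have "Ft * Wt * (W * F) = Ft * ((Wt * W) * F)"
    using W F Wt Ft by (simp add: assoc_mult_mat[of _ n n _ n _ n])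
  then have "transpose_mat (W * F) * (W * F) = 1\<^sub>m n"
    using F by (simp add: tWF WtW FtF)
  moreover have "Ft * Wt * (A * (W * F)) = Ft * (A' * F)"
    unfolding A'_def using A W F Wt Ft by (simp add: assoc_mult_mat[of _ n n _ n _ n])
  then have "transpose_mat (W * F) * (A * (W * F)) = mat_diag n (\<lambda>i. (e # es) ! i)"
    by (simp add: tWF FtAF)
  ultimately show ?case using W F by (intro bexI[of _ "W * F"]) auto
qed

text \<open>
  A zero row makes the system square and singular.
\<close>

lemma underdetermined_system_nonzero_solution:
  fixes c :: "nat \<Rightarrow> nat \<Rightarrow> real"
  obtains y where "y \<in> carrier_vec (Suc j)" "y \<noteq> 0\<^sub>v (Suc j)"
    "\<And>m. m < j \<Longrightarrow> (\<Sum>i<Suc j. c m i * y $ i) = 0"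
proof -
  define M where "M = mat (Suc j) (Suc j) (\<lambda>(m,i). if m < j then c m i else 0)"
  have M: "M \<in> carrier_mat (Suc j) (Suc j)" by (simp add: M_def)
  have "transpose_mat M *\<^sub>v unit_vec (Suc j) j = 0\<^sub>v (Suc j)"
    by (rule eq_vecI) (auto simp: M_def)
  then have "det (transpose_mat M) = 0"
    using det_0_iff_vec_prod_zero_field[of "transpose_mat M" "Suc j"] M
    by (auto intro!: exI[of _ "unit_vec (Suc j) j"])
  then obtain y where y: "y \<in> carrier_vec (Suc j)" "y \<noteq> 0\<^sub>v (Suc j)" "M *\<^sub>v y = 0\<^sub>v (Suc j)"
    using det_0_iff_vec_prod_zero_field[OF M] det_transpose[OF M] by auto
  have "(\<Sum>i<Suc j. c m i * y $ i) = 0" if "m < j" for m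
  proof -
    have "(\<Sum>i<Suc j. c m i * y $ i) = (M *\<^sub>v y) $ m"
      using that y(1) by (simp add: M_def scalar_prod_def atLeast0LessThan)
    then show ?thesis using that by (simp add: y(3))
  qed
  with y show ?thesis using that by blast
qed

text \<open>
  One half of the Courant--Fischer principle: \<open>j\<close> linear conditions cannot exclude the whole
  \<open>(j + 1)\<close>-dimensional span of the eigenvectors for \<open>es ! 0, \<dots>, es ! j\<close>, and on that span the Rayleigh
  quotient is at least \<open>es ! j\<close>.
\<close>

lemma symmetric_rayleigh_lower_bound:
  fixes A :: "real mat" and c :: "nat \<Rightarrow> nat \<Rightarrow> real"
  assumes A: "A \<in> carrier_mat n n" and sym: "transpose_mat A = A"
    and cp: "char_poly A = (\<Prod>e\<leftarrow>es. [:- e, 1:])"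
    and sorted: "sorted (rev es)" and j: "j < n"
  obtains x where "x \<in> carrier_vec n" "0 < x \<bullet> x"
    "\<And>m. m < j \<Longrightarrow> (\<Sum>k<n. c m k * x $ k) = 0"
    "es ! j * (x \<bullet> x) \<le> x \<bullet> (A *\<^sub>v x)"
proof -
  obtain P where P: "P \<in> carrier_mat n n" and PP: "transpose_mat P * P = 1\<^sub>m n"
    and D: "transpose_mat P * (A * P) = mat_diag n (\<lambda>i. es ! i)"
    using symmetric_orthogonal_diagonalization[OF A sym cp] by blast
  have len: "length es = n"
  proof -
    show ?thesis using degree_monic_char_poly[OF A] degree_linear_factors[of uminus es] by (simp add: cp)
  qed
  obtain y where y: "y \<in> carrier_vec (Suc j)" "y \<noteq> 0\<^sub>v (Suc j)"
    and y0: "\<And>m. m < j \<Longrightarrow> (\<Sum>i<Suc j. (\<Sum>k<n. c m k * P $$ (k,i)) * y $ i) = 0"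
    using underdetermined_system_nonzero_solution[of j "\<lambda>m i. \<Sum>k<n. c m k * P $$ (k,i)"] by blast
  \<comment> \<open>the coordinates of \<open>x\<close> in the eigenbasis\<close>
  define z where "z = vec n (\<lambda>i. if i \<le> j then y $ i else 0)"
  define x where "x = P *\<^sub>v z"
  have z: "z \<in> carrier_vec n" by (simp add: z_def)
  have x: "x \<in> carrier_vec n" using P z by (simp add: x_def)
  have zi: "z $ i = (if i \<le> j then y $ i else 0)" if "i < n" for i
    using that by (simp add: z_def)
  have zz: "z \<bullet> z = (\<Sum>i<n. (z $ i)\<^sup>2)"
    by (rule scalar_prod_self_eq_sum[OF z])
  have Pt: "transpose_mat P \<in> carrier_mat n n" using P by simp
  have "transpose_mat P *\<^sub>v x = z"
    using assoc_mult_mat_vec[OF Pt P z] z by (simp add: x_def PP)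
  then have xx: "x \<bullet> x = z \<bullet> z"
    using transpose_vec_mult_scalar[OF P z x] by (simp add: x_def)
  have "x \<bullet> (A *\<^sub>v x) = (A *\<^sub>v x) \<bullet> (P *\<^sub>v z)"
    using A x by (subst comm_scalar_prod[of _ n]) (auto simp: x_def[symmetric])
  also have "\<dots> = (transpose_mat P *\<^sub>v (A *\<^sub>v x)) \<bullet> z"
    using transpose_vec_mult_scalar[OF P z, of "A *\<^sub>v x"] A x by simp
  also have "transpose_mat P *\<^sub>v (A *\<^sub>v x) = (transpose_mat P * (A * P)) *\<^sub>v z"
    using assoc_mult_mat_vec[OF Pt mult_carrier_mat[OF A P] z] assoc_mult_mat_vec[OF A P z]
    by (simp add: x_def)
  also have "\<dots> \<bullet> z = (\<Sum>i<n. es ! i * (z $ i)\<^sup>2)"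
  proof -
    have "(mat_diag n (\<lambda>i. es ! i) *\<^sub>v z) $ i = es ! i * z $ i" if "i < n" for i
    proof -
      have "(mat_diag n (\<lambda>i. es ! i) *\<^sub>v z) $ i = (\<Sum>k<n. (if i = k then es ! k else 0) * z $ k)"
        using that z by (simp add: mat_diag_def scalar_prod_def atLeast0LessThan)
      also have "\<dots> = (\<Sum>k<n. if i = k then es ! k * z $ k else 0)"
        by (intro sum.cong) auto
      finally show ?thesis using that by simp
    qed
    then show ?thesis
      using z by (simp add: D scalar_prod_def power2_eq_square atLeast0LessThan mult.assoc)
  qed
  finally have xAx: "x \<bullet> (A *\<^sub>v x) = (\<Sum>i<n. es ! i * (z $ i)\<^sup>2)" .
  have "es ! j * (z $ i)\<^sup>2 \<le> es ! i * (z $ i)\<^sup>2" if "i < n" for i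
  proof (cases "i \<le> j")
    case True
    have "es ! j \<le> es ! i"
      using sorted_rev_nth_mono[OF sorted True] j len by simp
    then show ?thesis by (simp add: mult_right_mono)
  qed (use zi that in simp)
  then have "es ! j * (x \<bullet> x) \<le> x \<bullet> (A *\<^sub>v x)"
    unfolding xx zz xAx sum_distrib_left by (intro sum_mono) auto
  moreover have "0 < x \<bullet> x"
  proof -
    obtain i where i: "i < Suc j" "y $ i \<noteq> 0"
      using y by (metis carrier_vecD eq_vecI index_zero_vec)
    then have "z $ i \<noteq> 0" using j zi[of i] by simp
    then have "z \<noteq> 0\<^sub>v n" using i j by auto
    then show ?thesis unfolding xx by (rule scalar_prod_self_pos[OF z])
  qed
  moreover have "(\<Sum>k<n. c m k * x $ k) = 0" if "m < j" for m
  proof -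
    have "(\<Sum>k<n. c m k * x $ k) = (\<Sum>k<n. \<Sum>i<n. c m k * P $$ (k,i) * z $ i)"
      using P z by (intro sum.cong refl)
        (simp add: x_def scalar_prod_def atLeast0LessThan sum_distrib_left mult.assoc)
    also have "\<dots> = (\<Sum>i<n. (\<Sum>k<n. c m k * P $$ (k,i)) * z $ i)"
      by (subst sum.swap) (simp add: sum_distrib_right)
    also have "\<dots> = (\<Sum>i<Suc j. (\<Sum>k<n. c m k * P $$ (k,i)) * z $ i)"
      using j by (intro sum.mono_neutral_right) (auto simp: zi)
    also have "\<dots> = (\<Sum>i<Suc j. (\<Sum>k<n. c m k * P $$ (k,i)) * y $ i)"
      using j by (intro sum.cong) (auto simp: zi)
    finally show ?thesis using y0[OF that] by simp
  qed
  ultimately show ?thesis using x that by blast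
qed

section \<open>Singular values\<close>

text \<open>
  The root of a negative number is the negative of the root of its absolute value in HOL, so
  \<open>sqrt\<close> is monotone on all reals and preserves the order of the list.
\<close>

lemma singular_values_eq_map_sqrt:
  assumes cp: "char_poly (transpose_mat G * G) = (\<Prod>e\<leftarrow>es. [:- e, 1:])"
    and sorted: "sorted (rev es)"
  shows "singular_values G = map sqrt es"
proof -
  have "proots (\<Prod>e\<leftarrow>es. [:- e, 1:]) = (\<Sum>p\<leftarrow>map (\<lambda>e. [:- e, 1:]) es. proots p)"
    using proots_prod_list[of "map (\<lambda>e. [:- e, 1:]) es"] by fastforce
  also have "\<dots> = mset es" by (induction es) auto
  finally have "image_mset sqrt (proots (char_poly (transpose_mat G * G))) = mset (map sqrt es)"
    by (simp add: cp)
  moreover have "sort (map sqrt es) = rev (map sqrt es)"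
  proof (rule properties_for_sort)
    show "sorted (rev (map sqrt es))"
      using sorted unfolding rev_map sorted_map
      by (rule sorted_wrt_mono_rel[rotated]) simp
  qed simp
  ultimately show ?thesis
    by (simp only: singular_values_def sorted_list_of_multiset_mset rev_rev_ident)
qed

text \<open>
  This is the perturbation bound behind the Eckart--Young theorem, with the rank-\<open>j\<close> approximation given as a
  product of an \<open>n \<times> j\<close> and a \<open>j \<times> s\<close> matrix and the operator norm of the error estimated through
  its entries. The test vector \<open>x\<close> is orthogonal to all rows \<open>c m\<close>, so that \<open>G\<close> acts on it like the error.
  The lower bound, which holds since \<open>G\<^sup>T G\<close> is positive semidefinite, turns the estimate into one for
  the absolute value.
\<close>

lemma singular_value_le_of_low_rank_approx:
  fixes G :: "real mat" and a c :: "nat \<Rightarrow> nat \<Rightarrow> real"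
  assumes G: "G \<in> carrier_mat n s" and j: "j < s" and r: "0 \<le> r"
    and approx: "\<And>i k. i < n \<Longrightarrow> k < s \<Longrightarrow> \<bar>G $$ (i,k) - (\<Sum>m<j. a i m * c m k)\<bar> \<le> r"
  shows "0 \<le> singular_value G (j + 1)" "singular_value G (j + 1) \<le> sqrt (real n * real s) * r"
proof -
  define A where "A = transpose_mat G * G"
  have Gt: "transpose_mat G \<in> carrier_mat s n" using G by simp
  have A: "A \<in> carrier_mat s s" using G by (simp add: A_def)
  have sym: "transpose_mat A = A"
    using transpose_mult[OF Gt G] by (simp add: A_def)
  have quad: "x \<bullet> (A *\<^sub>v x) = (G *\<^sub>v x) \<bullet> (G *\<^sub>v x)" if x: "x \<in> carrier_vec s" for x
  proof -
    have "x \<bullet> (A *\<^sub>v x) = (A *\<^sub>v x) \<bullet> x"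
      using A x by (intro comm_scalar_prod[of _ s]) auto
    also have "\<dots> = (transpose_mat G *\<^sub>v (G *\<^sub>v x)) \<bullet> x"
      unfolding A_def using Gt G x by simp
    finally show ?thesis using transpose_vec_mult_scalar[OF G x, of "G *\<^sub>v x"] G x by simp
  qed
  obtain es0 where es0: "char_poly A = (\<Prod>e\<leftarrow>es0. [:- e, 1:])"
    using char_poly_symmetric_splits[OF A sym] .
  define es where "es = rev (sort es0)"
  have cp: "char_poly A = (\<Prod>e\<leftarrow>es. [:- e, 1:])"
  proof -
    have "mset (map (\<lambda>e. [:- e, 1:]) es) = mset (map (\<lambda>e. [:- e, 1:]) es0)"
      by (simp add: es_def)
    then show ?thesis unfolding es0 by (metis prod_mset_prod_list)
  qed
  have sorted: "sorted (rev es)" by (simp add: es_def)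
  have len: "length es = s"
  proof -
    show ?thesis using degree_monic_char_poly[OF A] degree_linear_factors[of uminus es] by (simp add: cp)
  qed
  have sv: "singular_value G (j + 1) = sqrt (es ! j)"
    using singular_values_eq_map_sqrt[OF cp[unfolded A_def] sorted] j len
    by (simp add: singular_value_def)
  obtain x where x: "x \<in> carrier_vec s" "0 < x \<bullet> x"
    and c0: "\<And>m. m < j \<Longrightarrow> (\<Sum>k<s. c m k * x $ k) = 0"
    and ray: "es ! j * (x \<bullet> x) \<le> x \<bullet> (A *\<^sub>v x)"
    using symmetric_rayleigh_lower_bound[OF A sym cp sorted j, of c] by blast
  have entry: "((G *\<^sub>v x) $ i)\<^sup>2 \<le> r\<^sup>2 * (real s * (x \<bullet> x))" if i: "i < n" for i
  proof -
    have "(\<Sum>k<s. (\<Sum>m<j. a i m * c m k) * x $ k) = (\<Sum>m<j. a i m * (\<Sum>k<s. c m k * x $ k))"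
      unfolding sum_distrib_left sum_distrib_right by (subst sum.swap) (simp add: mult.assoc)
    also have "\<dots> = 0" by (simp add: c0)
    finally have "(G *\<^sub>v x) $ i = (\<Sum>k<s. (G $$ (i,k) - (\<Sum>m<j. a i m * c m k)) * x $ k)"
      using i G x(1) by (simp add: scalar_prod_def atLeast0LessThan left_diff_distrib sum_subtractf)
    also have "\<bar>\<dots>\<bar> \<le> (\<Sum>k<s. r * \<bar>x $ k\<bar>)"
      using i approx by (intro order_trans[OF sum_abs] sum_mono) (auto simp: abs_mult intro!: mult_right_mono)
    finally have "\<bar>(G *\<^sub>v x) $ i\<bar> \<le> r * (\<Sum>k<s. \<bar>x $ k\<bar>)"
      by (simp add: sum_distrib_left)
    then have "\<bar>(G *\<^sub>v x) $ i\<bar>\<^sup>2 \<le> (r * (\<Sum>k<s. \<bar>x $ k\<bar>))\<^sup>2"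
      by (intro power_mono) auto
    also have "\<dots> = r\<^sup>2 * (\<Sum>k<s. \<bar>x $ k\<bar>)\<^sup>2" by (simp add: power_mult_distrib)
    also have "(\<Sum>k<s. \<bar>x $ k\<bar>)\<^sup>2 \<le> real s * (x \<bullet> x)"
      using sum_squared_le_sum_of_squares[of "\<lambda>k. \<bar>x $ k\<bar>" "{..<s}"] scalar_prod_self_eq_sum[OF x(1)] by (simp add: mult.commute)
    finally show ?thesis by (simp add: mult_left_mono)
  qed
  have "es ! j * (x \<bullet> x) \<le> (\<Sum>i<n. ((G *\<^sub>v x) $ i)\<^sup>2)"
    using ray quad[OF x(1)] scalar_prod_self_eq_sum[OF mult_mat_vec_carrier[OF G x(1)]] by simp
  also have "\<dots> \<le> (\<Sum>i<n. r\<^sup>2 * (real s * (x \<bullet> x)))"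
    using entry by (intro sum_mono) auto
  also have "\<dots> = (real n * real s * r\<^sup>2) * (x \<bullet> x)" by simp
  finally have "es ! j \<le> real n * real s * r\<^sup>2"
    using x(2) by simp
  then have "sqrt (es ! j) \<le> sqrt (real n * real s * r\<^sup>2)"
    by simp
  then show "singular_value G (j + 1) \<le> sqrt (real n * real s) * r"
    using r sv by (simp add: real_sqrt_mult)
  have "poly (char_poly A) (es ! j) = 0"
    using nth_mem[of j es] j len unfolding cp poly_prod_list prod_list_zero_iff by force
  then obtain v where v: "v \<in> carrier_vec s" "v \<noteq> 0\<^sub>v s" "A *\<^sub>v v = (es ! j) \<cdot>\<^sub>v v"
    using eigenvalue_root_char_poly[OF A] A unfolding eigenvalue_def eigenvector_def by auto
  have "(es ! j) * (v \<bullet> v) = (G *\<^sub>v v) \<bullet> (G *\<^sub>v v)"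
    using quad[OF v(1)] v by simp
  then have "0 \<le> (es ! j) * (v \<bullet> v)"
    using scalar_prod_self_eq_sum[OF mult_mat_vec_carrier[OF G v(1)]] by (simp add: sum_nonneg)
  moreover have "0 < v \<bullet> v" using v by (intro scalar_prod_self_pos)
  ultimately have "0 \<le> es ! j" by (simp add: zero_le_mult_iff)
  then show "0 \<le> singular_value G (j + 1)" using sv by simp
qed

section \<open>Norms on vectors of fixed dimension\<close>

lemma norm_on_carrier_vecD:
  assumes "norm_on_carrier_vec n N" "x \<in> carrier_vec n"
  shows "0 \<le> N x" "N x = 0 \<longleftrightarrow> x = 0\<^sub>v n" "N (c \<cdot>\<^sub>v x) = \<bar>c\<bar> * N x"
    and "y \<in> carrier_vec n \<Longrightarrow> N (x + y) \<le> N x + N y"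
  using assms unfolding norm_on_carrier_vec_def by blast+

lemma norm_le_sum_coordinates:
  assumes N: "norm_on_carrier_vec n N" and x: "x \<in> carrier_vec n"
  shows "N x \<le> (\<Sum>i<n. \<bar>x $ i\<bar> * N (unit_vec n i))"
proof -
  let ?p = "\<lambda>k. vec n (\<lambda>i. if i < k then x $ i else 0)"
  have "N (?p k) \<le> (\<Sum>i<k. \<bar>x $ i\<bar> * N (unit_vec n i))" if "k \<le> n" for k
    using that
  proof (induction k)
    case 0
    have "?p 0 = 0\<^sub>v n" by (intro eq_vecI) auto
    moreover have "N (0\<^sub>v n) = 0" using norm_on_carrier_vecD(2)[OF N zero_carrier_vec] by simp
    ultimately show ?case by simp
  next
    case (Suc k)
    have "?p (Suc k) = ?p k + x $ k \<cdot>\<^sub>v unit_vec n k"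
      using Suc.prems by (intro eq_vecI) (auto simp: less_Suc_eq)
    then have "N (?p (Suc k)) \<le> N (?p k) + N (x $ k \<cdot>\<^sub>v unit_vec n k)"
      using norm_on_carrier_vecD(4)[OF N, of "?p k" "x $ k \<cdot>\<^sub>v unit_vec n k"] by simp
    also have "N (x $ k \<cdot>\<^sub>v unit_vec n k) = \<bar>x $ k\<bar> * N (unit_vec n k)"
      by (rule norm_on_carrier_vecD(3)[OF N unit_vec_carrier])
    finally show ?case using Suc by simp
  qed
  moreover have "?p n = x" using x by (intro eq_vecI) auto
  ultimately show ?thesis by fastforce
qed

text \<open>
  Vectors are represented by functions on the natural numbers, because that type carries a topology, the
  product topology, in which the compactness argument below can be carried out.
\<close>

lemma norm_on_carrier_vec_continuous:
  assumes N: "norm_on_carrier_vec n N"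
  shows "continuous_on S (\<lambda>x :: nat \<Rightarrow> real. N (vec n x))"
  unfolding continuous_on_def
proof
  fix x assume "x \<in> S"
  let ?b = "\<lambda>y. \<Sum>i<n. \<bar>y i - x i\<bar> * N (unit_vec n i)"
  have tri: "N (vec n u) \<le> N (vec n w) + (\<Sum>i<n. \<bar>u i - w i\<bar> * N (unit_vec n i))" for u w
  proof -
    have "vec n u = vec n w + vec n (\<lambda>i. u i - w i)" by (intro eq_vecI) auto
    then have "N (vec n u) \<le> N (vec n w) + N (vec n (\<lambda>i. u i - w i))"
      using norm_on_carrier_vecD(4)[OF N, of "vec n w" "vec n (\<lambda>i. u i - w i)"] by simp
    then show ?thesis
      using norm_le_sum_coordinates[OF N, of "vec n (\<lambda>i. u i - w i)"] by simp
  qed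
  have bound: "norm (N (vec n y) - N (vec n x)) \<le> ?b y" for y
    using tri[of y x] tri[of x y] by (simp add: abs_minus_commute abs_le_iff)
  have "((\<lambda>y. y i) \<longlongrightarrow> x i) (at x within S)" for i
    using continuous_on_product_coordinates[of i] \<open>x \<in> S\<close>
    by (auto simp: continuous_on_def intro: tendsto_within_subset)
  then have "(?b \<longlongrightarrow> (\<Sum>i<n. \<bar>x i - x i\<bar> * N (unit_vec n i))) (at x within S)"
    by (intro tendsto_intros)
  then have "(?b \<longlongrightarrow> 0) (at x within S)" by simp
  then have "((\<lambda>y. N (vec n y) - N (vec n x)) \<longlongrightarrow> 0) (at x within S)"
    by (rule Lim_null_comparison[rotated]) (intro always_eventually allI bound)
  then show "((\<lambda>y. N (vec n y)) \<longlongrightarrow> N (vec n x)) (at x within S)"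
    by (rule Lim_null[THEN iffD2])
qed

text \<open>
  The boundary of the unit cube is, up to sign, the union of the faces \<open>S p\<close> on which coordinate \<open>p\<close>
  is \<open>1\<close>. Each face is compact and avoids \<open>0\<close>, so the norm has a positive minimum \<open>m p\<close> there. Dividing a
  vector by its coordinate \<open>p\<close> of largest absolute value moves it to the face \<open>S p\<close>.
\<close>

lemma coordinate_le_norm:
  assumes N: "norm_on_carrier_vec n N"
  obtains K where "0 < K" "\<And>x i. x \<in> carrier_vec n \<Longrightarrow> i < n \<Longrightarrow> \<bar>x $ i\<bar> \<le> K * N x"
proof -
  \<comment> \<open>The values at \<open>k \<ge> n\<close>, which \<open>vec n\<close> ignores, are fixed to keep \<open>S p\<close> compact.\<close>
  define S where "S = (\<lambda>p. {x :: nat \<Rightarrow> real. x p = 1 \<and> (\<forall>k<n. \<bar>x k\<bar> \<le> 1) \<and> (\<forall>k\<ge>n. x k = 0)})"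
  have "\<exists>m>0. \<forall>x\<in>S p. m \<le> N (vec n x)" if p: "p < n" for p
  proof -
    define X where "X = (\<lambda>k. if k = p then {1} else if k < n then {- 1..1} else {0::real})"
    have S_eq: "S p = PiE UNIV X"
    proof (intro equalityI subsetI)
      fix x assume "x \<in> S p"
      then show "x \<in> PiE UNIV X" using p by (auto simp: S_def X_def abs_le_iff)
    next
      fix x assume "x \<in> PiE UNIV X"
      then have X: "x k \<in> X k" for k by auto
      have "\<bar>x k\<bar> \<le> 1" if "k < n" for k
        using X[of k] that by (auto simp: X_def split: if_splits)
      moreover have "x k = 0" if "k \<ge> n" for k
        using X[of k] that p by (auto simp: X_def split: if_splits)
      ultimately show "x \<in> S p"
        using X[of p] by (simp add: S_def X_def)
    qed
    have "compactin (product_topology (\<lambda>_. euclidean) UNIV) (PiE UNIV X)"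
      unfolding compactin_PiE by (auto simp: X_def)
    then have "compact (S p)" by (simp add: S_eq euclidean_product_topology)
    moreover have "S p \<noteq> {}"
      using p by (auto simp: S_def intro!: exI[of _ "\<lambda>k. if k = p then 1 else 0"])
    ultimately obtain x where x: "x \<in> S p" "\<forall>y\<in>S p. N (vec n x) \<le> N (vec n y)"
      using continuous_attains_inf[OF _ _ norm_on_carrier_vec_continuous[OF N]] by blast
    have "vec n x $ p = 1" using x(1) p by (simp add: S_def)
    then have "vec n x \<noteq> 0\<^sub>v n" using index_zero_vec(1)[OF p, where 'a = real] by force
    then have "N (vec n x) > 0"
      using norm_on_carrier_vecD(1,2)[OF N vec_carrier[of n x]] by simp
    with x(2) show ?thesis by blast
  qed
  then have "\<forall>p\<in>{..<n}. \<exists>m. 0 < m \<and> (\<forall>x\<in>S p. m \<le> N (vec n x))" by blast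
  from bchoice[OF this] obtain m where m: "\<And>p. p < n \<Longrightarrow> 0 < m p"
    "\<And>p x. p < n \<Longrightarrow> x \<in> S p \<Longrightarrow> m p \<le> N (vec n x)" by auto
  \<comment> \<open>A sum instead of a maximum, and the summand \<open>1\<close>, also cover \<open>n = 0\<close>.\<close>
  define K where "K = 1 + (\<Sum>p<n. 1 / m p)"
  have Kp: "1 / m p \<le> K" if "p < n" for p
  proof -
    have "1 / m p \<le> (\<Sum>p<n. 1 / m p)"
      using m(1) that by (intro member_le_sum) (auto simp: less_imp_le)
    then show ?thesis by (simp add: K_def)
  qed
  have "0 < K"
    unfolding K_def using m(1) by (intro add_pos_nonneg sum_nonneg) (auto simp: less_imp_le)
  moreover have "\<bar>x $ i\<bar> \<le> K * N x" if x: "x \<in> carrier_vec n" and i: "i < n" for x i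
  proof -
    have N0: "0 \<le> N x" by (rule norm_on_carrier_vecD(1)[OF N x])
    obtain p where p: "p < n" and pmax: "\<And>k. k < n \<Longrightarrow> \<bar>x $ k\<bar> \<le> \<bar>x $ p\<bar>"
    proof -
      have "Max ((\<lambda>k. \<bar>x $ k\<bar>) ` {..<n}) \<in> (\<lambda>k. \<bar>x $ k\<bar>) ` {..<n}"
        using i by (intro Max_in) auto
      then obtain p where p: "p < n" "Max ((\<lambda>k. \<bar>x $ k\<bar>) ` {..<n}) = \<bar>x $ p\<bar>" by auto
      have "\<bar>x $ k\<bar> \<le> \<bar>x $ p\<bar>" if "k < n" for k
        unfolding p(2)[symmetric] using that by (intro Max_ge) auto
      with p(1) show ?thesis by (rule that)
    qed
    show ?thesis
    proof (cases "x $ p = 0")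
      case True
      then show ?thesis using pmax[OF i] N0 \<open>0 < K\<close> by simp
    next
      case False
      define y where "y = (\<lambda>k. if k < n then x $ k / x $ p else 0)"
      have "y \<in> S p" using p pmax False by (simp add: S_def y_def)
      then have "m p \<le> N (vec n y)" using m(2) p by blast
      also have "vec n y = (1 / x $ p) \<cdot>\<^sub>v x" using x by (intro eq_vecI) (auto simp: y_def)
      also have "N \<dots> = N x / \<bar>x $ p\<bar>"
        using norm_on_carrier_vecD(3)[OF N x, of "1 / x $ p"] by simp
      finally have "\<bar>x $ p\<bar> \<le> 1 / m p * N x"
        using False m(1)[OF p] by (simp add: pos_le_divide_eq mult.commute)
      also have "\<dots> \<le> K * N x" using Kp[OF p] N0 by (rule mult_right_mono)
      finally show ?thesis using pmax[OF i] by simp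
    qed
  qed
  ultimately show ?thesis by (rule that)
qed

section \<open>Smooth curves\<close>

lemma smooth_curve_DERIV:
  assumes "smooth_curve n g" "i < n"
  shows "DERIV ((deriv ^^ j) (\<lambda>u. g u $ i)) t :> (deriv ^^ Suc j) (\<lambda>u. g u $ i) t"
proof -
  have "(deriv ^^ j) (\<lambda>u. g u $ i) differentiable (at t)"
    using assms unfolding smooth_curve_def by blast
  then show ?thesis
    unfolding funpow.simps comp_apply by (rule DERIV_deriv_iff_real_differentiable[THEN iffD2])
qed

text \<open>
  A supremum over an unbounded set would be an arbitrary real, so the point is boundedness: the norm is
  dominated by a sum that depends continuously on time.
\<close>

lemma norm_curve_deriv_le_max_deriv:
  assumes N: "norm_on_carrier_vec n N" and g: "smooth_curve n g" and t: "t \<in> {0..T}"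
  shows "N (curve_deriv n j g t) \<le> max_deriv n N g j T"
proof -
  let ?b = "\<lambda>u. \<Sum>i<n. \<bar>(deriv ^^ j) (\<lambda>u. g u $ i) u\<bar> * N (unit_vec n i)"
  have "continuous_on {0..T} ((deriv ^^ j) (\<lambda>u. g u $ i))" if "i < n" for i
    using DERIV_isCont[OF smooth_curve_DERIV[OF g that]] by (intro continuous_at_imp_continuous_on) blast
  then have "continuous_on {0..T} ?b" by (intro continuous_intros) auto
  then have "bdd_above (?b ` {0..T})"
    by (intro bounded_imp_bdd_above compact_imp_bounded compact_continuous_image) auto
  then obtain c where c: "\<And>u. u \<in> {0..T} \<Longrightarrow> ?b u \<le> c"
    unfolding bdd_above_def by blast
  have "N (curve_deriv n j g u) \<le> c" if "u \<in> {0..T}" for u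
    using norm_le_sum_coordinates[OF N, of "curve_deriv n j g u"] c[OF that]
    by (simp add: curve_deriv_def)
  then have "bdd_above ((\<lambda>u. N (curve_deriv n j g u)) ` {0..T})"
    by (rule bdd_aboveI2)
  then show ?thesis unfolding max_deriv_def using t by (rule cSUP_upper[rotated])
qed

lemma taylor_remainder_bound:
  fixes D :: "nat \<Rightarrow> real \<Rightarrow> real"
  assumes D: "\<And>m u. DERIV (D m) u :> D (Suc m) u"
    and bound: "\<And>u. u \<in> {0..T} \<Longrightarrow> \<bar>D j u\<bar> \<le> b"
    and t: "t \<in> {0..T}" and j: "0 < j"
  shows "\<bar>D 0 t - (\<Sum>m<j. D m 0 / fact m * t ^ m)\<bar> \<le> b * T ^ j"
proof -
  have b: "0 \<le> b" using bound[OF t] by linarith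
  obtain u where u: "\<bar>u\<bar> \<le> \<bar>t\<bar>" "0 \<le> u"
    and eq: "D 0 t = (\<Sum>m<j. D m 0 / fact m * t ^ m) + D j u / fact j * t ^ j"
  proof (cases "t = 0")
    case True
    then show ?thesis using that[of 0] Maclaurin_zero[of t j D] j by simp
  next
    case False
    then have "0 < t" using t by simp
    then obtain u where "0 < u" "u \<le> t"
      "D 0 t = (\<Sum>m<j. D m 0 / fact m * t ^ m) + D j u / fact j * t ^ j"
      using Maclaurin2[OF \<open>0 < t\<close> refl, of j D] D by auto
    then show ?thesis using that[of u] by simp
  qed
  have "\<bar>D j u / fact j * t ^ j\<bar> = \<bar>D j u\<bar> / fact j * t ^ j" using t by (simp add: abs_mult)
  also have "\<dots> \<le> b / 1 * T ^ j"
    using u t b bound[of u] by (intro mult_mono frac_le power_mono) auto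
  finally show ?thesis by (simp add: eq)
qed

section \<open>Decay of the singular values of the sample matrix\<close>

theorem theorem2p1:
  fixes n :: nat and N :: "real vec \<Rightarrow> real" and B :: real
  assumes "norm_on_carrier_vec n N"
  shows "\<exists>C>0. \<forall>\<^sub>F T in at_right 0.
    \<forall>(g :: real \<Rightarrow> real vec) (s :: nat) (t :: nat \<Rightarrow> real).
      smooth_curve n g \<longrightarrow>
      (\<forall>j\<le>n. max_deriv n N g j T \<le> B) \<longrightarrow>
      s < n \<longrightarrow>
      sample_points s T t \<longrightarrow>
      (\<forall>j\<in>{1..s-1}.
         \<bar>singular_value (sample_matrix n s g t) (j + 1)\<bar> \<le> C * \<bar>sqrt (real (s - j)) * T ^ j\<bar>)"
proof -
  obtain K where K: "0 < K" "\<And>x i. x \<in> carrier_vec n \<Longrightarrow> i < n \<Longrightarrow> \<bar>x $ i\<bar> \<le> K * N x"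
    using coordinate_le_norm[OF assms] by blast
  \<comment> \<open>\<open>n\<close> bounds \<open>sqrt (n * s)\<close>, the factor \<open>K * \<bar>B\<bar>\<close> bounds all coordinates of the derivatives, and \<open>1\<close> makes \<open>C\<close> positive.\<close>
  define C where "C = real n * (K * \<bar>B\<bar>) + 1"
  have C: "0 < C" unfolding C_def using K(1) by (intro add_nonneg_pos) auto
  have main: "\<bar>singular_value (sample_matrix n s g t) (j + 1)\<bar> \<le> C * \<bar>sqrt (real (s - j)) * T ^ j\<bar>"
    if T: "0 < T" and g: "smooth_curve n g" and M: "\<forall>j\<le>n. max_deriv n N g j T \<le> B"
      and s: "s < n" and pts: "sample_points s T t" and j: "j \<in> {1..s-1}" for T g s t j
  proof -
    let ?G = "sample_matrix n s g t"
    let ?D = "\<lambda>i m. (deriv ^^ m) (\<lambda>u. g u $ i)"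
    let ?r = "K * \<bar>B\<bar> * T ^ j"
    have js: "0 < j" "j < s" using j by auto
    have r: "0 \<le> ?r" using K(1) T by simp
    have gc: "g u \<in> carrier_vec n" for u using g by (simp add: smooth_curve_def)
    have G: "?G \<in> carrier_mat n s" by (simp add: sample_matrix_def mat_of_cols_def del: upt_Suc)
    have bound: "\<bar>?D i j u\<bar> \<le> K * \<bar>B\<bar>" if "i < n" "u \<in> {0..T}" for i u
    proof -
      have "\<bar>?D i j u\<bar> \<le> K * N (curve_deriv n j g u)"
        using K(2)[of "curve_deriv n j g u" i] that by (simp add: curve_deriv_def)
      also have "\<dots> \<le> K * \<bar>B\<bar>"
      proof (rule mult_left_mono)
        have "max_deriv n N g j T \<le> B" using M js s by simp
        then show "N (curve_deriv n j g u) \<le> \<bar>B\<bar>"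
          using norm_curve_deriv_le_max_deriv[OF assms g that(2), of j] by linarith
      qed (use K(1) in simp)
      finally show ?thesis .
    qed
    have tk: "t (Suc k) \<in> {0..T}" if "k < s" for k
    proof -
      have "strict_mono_on {1..s} t" "t 1 = 0" "t s = T"
        using pts by (auto simp: sample_points_def)
      moreover have "t 1 \<le> t (Suc k)" "t (Suc k) \<le> t s"
        by (rule strict_mono_on_leD[OF \<open>strict_mono_on {1..s} t\<close>]; use that in simp)+
      ultimately show ?thesis by simp
    qed
    \<comment> \<open>Columns are counted from \<open>0\<close>, sample points from \<open>1\<close>.\<close>
    have "\<bar>?G $$ (i,k) - (\<Sum>m<j. ?D i m 0 / fact m * t (Suc k) ^ m)\<bar> \<le> ?r"
      if "i < n" "k < s" for i k
    proof -
      have "?G $$ (i,k) = g (t (Suc k)) $ i"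
        using that gc by (simp add: sample_matrix_def mat_of_cols_index del: upt_Suc)
      then show ?thesis
        using taylor_remainder_bound[of "?D i", OF smooth_curve_DERIV[OF g that(1)]
            bound[OF that(1)] tk[OF that(2)] js(1)] by simp
    qed
    note approx = singular_value_le_of_low_rank_approx[OF G js(2) r this]
    have "singular_value ?G (j + 1) \<le> sqrt (real n * real s) * ?r" by (rule approx(2))
    also have "sqrt (real n * real s) \<le> real n"
      using s by (intro real_le_lsqrt) (auto simp: power2_eq_square intro: mult_left_mono)
    also have "real n * ?r = real n * (K * \<bar>B\<bar>) * T ^ j" by simp
    also have "\<dots> \<le> C * T ^ j"
      using T unfolding C_def by (intro mult_right_mono) auto
    also have "\<dots> = C * (1 * T ^ j)" by simp
    also have "\<dots> \<le> C * (sqrt (real (s - j)) * T ^ j)"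
      using C T js by (intro mult_left_mono mult_right_mono) auto
    finally show ?thesis
      using approx(1) T r js by (simp add: mult_right_mono mult_left_mono)
  qed
  have "\<forall>\<^sub>F T in at_right (0::real). 0 < T" by (rule eventually_at_right_less)
  then show ?thesis
    by (intro exI[of _ C] conjI C) (auto elim!: eventually_mono intro!: main simp del: One_nat_def)
qed

end
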